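(* Let $m\ge 2$ and $N\ge 1$ be integers. Then $$1+\sum_{n=1}^{N}\sum_{j=1}^{m-1}\frac{q^{mn-j}}{\left(\prod_{r=1}^{m-j}(q^r;q^m)_n\right)\cdot\left(\prod_{r=m-j+1}^{m-1}(q^r;q^m)_{n-1}\right)}=\frac{(q^m;q^m)_{N}}{(q;q)_{mN}}.$$
   Context: For a complex $A$ and integer $K\ge 0$, $(A;q)_K=\prod_{i=0}^{K-1}(1-Aq^i)$, with $(A;q)_0=1$; the identity is of formal power series (or rational functions) in $q$. An empty product equals $1$. *)

theory Defs
  imports Complex_Main "HOL-Computational_Algebra.Formal_Power_Series"
begin

text \<open>
  The \<open>q\<close>-Pochhammer symbol $(A;q)_K$ in an arbitrary commutative ring, so that \<open>A\<close> and the base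
  can themselves be formal power series.
\<close>

definition qpochhammer :: "'a::comm_ring_1 \<Rightarrow> 'a \<Rightarrow> nat \<Rightarrow> 'a" where
  "qpochhammer A q K = (\<Prod>i<K. 1 - A * q ^ i)"

end

theory Submission
  imports Defs
begin

text \<open>
  Put $k = m - j$ and let $D_{n,k}$ be the denominator of the summand. Passing from $D_{n,k-1}$ to
  $D_{n,k}$ adds the single factor $1 - q^{m(n-1)+k}$, whose power of \<open>q\<close> is the numerator $q^{mn-j}$,
  so the summand is $1/D_{n,k} - 1/D_{n,k-1}$. As $D_{n,0} = D_{n-1,m-1}$, the double sum telescopes
  to $1/D_{N,m-1} - 1$, and splitting $(q;q)_{mN}$ by residues modulo \<open>m\<close> gives
  $(q;q)_{mN} = D_{N,m-1} (q^m;q^m)_N$.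
\<close>

lemma qpochhammer_0 [simp]: "qpochhammer A q 0 = 1"
  by (simp add: qpochhammer_def)

lemma qpochhammer_Suc: "qpochhammer A q (Suc n) = qpochhammer A q n * (1 - A * q ^ n)"
  by (simp add: qpochhammer_def)

lemma qpochhammer_add:
  "qpochhammer A q (k + n) = qpochhammer A q k * qpochhammer (A * q ^ k) q n"
  by (induction n) (simp_all add: qpochhammer_Suc power_add algebra_simps)

text \<open>Every exponent in \<open>1..m * n\<close> is uniquely r + m i with 1 \<le> r \<le> m and
  i < n. In the induction, the next block of m consecutive exponents gives each residue class
  exactly one new factor.\<close>

lemma qpochhammer_mult_index:
  "qpochhammer q q (m * n) = (\<Prod>r=1..m. qpochhammer (q ^ r) (q ^ m) n)"
proof (induction n)
  case (Suc n)
  have "qpochhammer (q * q ^ (m * n)) q m = (\<Prod>r=1..m. 1 - q ^ r * (q ^ m) ^ n)"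
    unfolding qpochhammer_def
    \<comment> \<open>The factors of the block are indexed from 0, the residue classes from
      1.\<close>
    by (rule prod.reindex_bij_witness[of _ "\<lambda>r. r - 1" Suc])
       (auto simp: power_mult mult.assoc)
  moreover have "qpochhammer q q (m * Suc n) =
      qpochhammer q q (m * n) * qpochhammer (q * q ^ (m * n)) q m"
    by (simp only: mult_Suc_right add.commute[of m] qpochhammer_add)
  ultimately show ?case
    using Suc by (simp add: qpochhammer_Suc prod.distrib)
qed simp

lemma fps_nth_qpochhammer_0:
  assumes "fps_nth A 0 = 0"
  shows "fps_nth (qpochhammer A q n) 0 = 1"
  by (induction n) (simp_all add: qpochhammer_Suc assms)

text \<open>Write x = 1 - (1 - x) in the numerator. The constant terms make d and 1 - x units, so
  division is multiplication by the inverse.\<close>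

lemma fps_divide_mult_one_minus:
  fixes x d :: "'a::field fps"
  assumes "fps_nth x 0 = 0" and "fps_nth d 0 \<noteq> 0"
  shows "x / (d * (1 - x)) = inverse (d * (1 - x)) - inverse d"
proof -
  have "inverse (1 - x) * (1 - x) = 1"
    by (rule inverse_mult_eq_1) (simp add: assms)
  then have "inverse d = inverse (d * (1 - x)) * (1 - x)"
    by (simp add: fps_inverse_mult mult.assoc)
  moreover have "x / (d * (1 - x)) = x * inverse (d * (1 - x))"
    by (rule fps_divide_unit) (simp add: assms)
  ultimately show ?thesis
    by (simp add: algebra_simps)
qed

text \<open>This is $D_{n,k}$. For n \<ge> 1 and k < m it is the product of all 1 - q^e with 1 \<le>
  e \<le> m(n-1) + k and e not divisible by m.\<close>

definition mixed_qpochhammer :: "'a::comm_ring_1 \<Rightarrow> nat \<Rightarrow> nat \<Rightarrow> nat \<Rightarrow> 'a" where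
  "mixed_qpochhammer q m n k =
     (\<Prod>r=1..k. qpochhammer (q ^ r) (q ^ m) n) *
     (\<Prod>r=k+1..m-1. qpochhammer (q ^ r) (q ^ m) (n - 1))"

text \<open>Only the residue class k + 1 changes: it leaves the second product for the first,
  growing from n - 1 to n factors.\<close>

lemma mixed_qpochhammer_Suc:
  assumes "Suc k < m" and "n \<ge> 1"
  shows "mixed_qpochhammer q m n (Suc k) =
           mixed_qpochhammer q m n k * (1 - q ^ (m * (n - 1) + Suc k))"
proof -
  obtain l where n: "n = Suc l"
    using assms by (cases n) auto
  have "{k+1..m-1} = insert (Suc k) {Suc k + 1..m-1}"
    using assms by auto
  moreover have "q ^ (m * l + Suc k) = q ^ Suc k * (q ^ m) ^ l"
    unfolding power_add power_mult by (rule mult.commute)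
  ultimately show ?thesis
    by (simp add: mixed_qpochhammer_def n qpochhammer_Suc mult_ac del: power_Suc)
qed

lemma mixed_qpochhammer_0:
  "mixed_qpochhammer q m (Suc n) 0 = mixed_qpochhammer q m n (m - 1)"
  by (simp add: mixed_qpochhammer_def)

text \<open>Constant term 1 makes the denominators units, as the inverses in the telescoping
  require.\<close>

lemma fps_nth_mixed_qpochhammer_0:
  fixes q :: "'a::comm_ring_1 fps"
  assumes "fps_nth q 0 = 0"
  shows "fps_nth (mixed_qpochhammer q m n k) 0 = 1"
proof -
  have prod: "fps_nth (prod f A) 0 = 1" if "\<And>r. r \<in> A \<Longrightarrow> fps_nth (f r) 0 = 1"
    for f :: "nat \<Rightarrow> 'a fps" and A
    using that by (induction A rule: infinite_finite_induct) auto
  have "fps_nth (qpochhammer (q ^ r) (q ^ m) l) 0 = 1" if "r \<ge> 1" for r l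
    using that assms by (intro fps_nth_qpochhammer_0) (simp add: fps_power_zeroth power_0_left)
  then have "fps_nth (mixed_qpochhammer q m n k) 0 = 1 * 1"
    unfolding mixed_qpochhammer_def fps_mult_nth_0
    by (intro arg_cong2[where f = "(*)"] prod) auto
  then show ?thesis
    by simp
qed

lemma mixed_qpochhammer_telescope_inner:
  fixes q :: "'a::field fps"
  assumes "fps_nth q 0 = 0" and "k < m" and "n \<ge> 1"
  shows "(\<Sum>i=1..k. q ^ (m * (n - 1) + i) / mixed_qpochhammer q m n i) =
           inverse (mixed_qpochhammer q m n k) - inverse (mixed_qpochhammer q m n 0)"
  using assms(2)
proof (induction k)
  case (Suc k)
  have "q ^ (m * (n - 1) + Suc k) / mixed_qpochhammer q m n (Suc k) =
          inverse (mixed_qpochhammer q m n (Suc k)) - inverse (mixed_qpochhammer q m n k)"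
    unfolding mixed_qpochhammer_Suc[OF Suc.prems assms(3)]
    by (rule fps_divide_mult_one_minus)
       (simp_all add: assms fps_power_zeroth fps_nth_mixed_qpochhammer_0)
  with Suc show ?case
    by simp
qed simp

lemma mixed_qpochhammer_telescope:
  fixes q :: "'a::field fps"
  assumes "fps_nth q 0 = 0" and "m \<ge> 1"
  shows "1 + (\<Sum>n=1..N. \<Sum>k=1..m-1. q ^ (m * (n - 1) + k) / mixed_qpochhammer q m n k) =
           inverse (mixed_qpochhammer q m N (m - 1))"
proof (induction N)
  case 0
  \<comment> \<open>Since 0 - 1 = 0 on naturals, all factors of $D_{0,m-1}$ are empty
    products.\<close>
  show ?case
    by (simp add: mixed_qpochhammer_def)
next
  case (Suc N)
  have "(\<Sum>k=1..m-1. q ^ (m * (Suc N - 1) + k) / mixed_qpochhammer q m (Suc N) k) =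
          inverse (mixed_qpochhammer q m (Suc N) (m - 1)) - inverse (mixed_qpochhammer q m N (m - 1))"
    unfolding mixed_qpochhammer_0[of q m N, symmetric]
    using assms by (intro mixed_qpochhammer_telescope_inner) simp_all
  with Suc show ?case
    by (simp add: add.assoc[symmetric])
qed

theorem theorem1p9:
  fixes m N :: nat and q :: "complex fps"
  assumes "m \<ge> 2" and "N \<ge> 1"
  defines "q \<equiv> fps_X"
  shows "1 + (\<Sum>n=1..N. \<Sum>j=1..m-1.
            q ^ (m * n - j) /
              ((\<Prod>r=1..m-j. qpochhammer (q ^ r) (q ^ m) n) *
               (\<Prod>r=m-j+1..m-1. qpochhammer (q ^ r) (q ^ m) (n - 1))))
         = qpochhammer (q ^ m) (q ^ m) N / qpochhammer q q (m * N)"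
proof -
  let ?D = "mixed_qpochhammer q m" and ?P = "qpochhammer (q ^ m) (q ^ m) N"
  have q0: "fps_nth q 0 = 0"
    by (simp add: q_def)
  have D0: "fps_nth (?D N (m - 1)) 0 = 1"
    by (rule fps_nth_mixed_qpochhammer_0[OF q0])
  have P0: "fps_nth ?P 0 = 1"
    using assms(1) q0 by (intro fps_nth_qpochhammer_0) (simp add: fps_power_zeroth power_0_left)
  have "(\<Sum>j=1..m-1. q ^ (m * n - j) / ?D n (m - j)) =
          (\<Sum>k=1..m-1. q ^ (m * (n - 1) + k) / ?D n k)" if "n \<ge> 1" for n
  proof (rule sum.reindex_bij_witness[of _ "\<lambda>k. m - k" "\<lambda>j. m - j"])
    fix j assume j: "j \<in> {1..m-1}"
    \<comment> \<open>Here n \<ge> 1 matters, because the subtraction is truncated.\<close>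
    have "m * n = m * (n - 1) + m"
      using that by (cases n) auto
    with j have "m * (n - 1) + (m - j) = m * n - j"
      by auto
    then show "q ^ (m * (n - 1) + (m - j)) / ?D n (m - j) = q ^ (m * n - j) / ?D n (m - j)"
      by simp
  qed auto
  then have "1 + (\<Sum>n=1..N. \<Sum>j=1..m-1. q ^ (m * n - j) / ?D n (m - j)) =
          1 + (\<Sum>n=1..N. \<Sum>k=1..m-1. q ^ (m * (n - 1) + k) / ?D n k)"
    by simp
  also have "\<dots> = inverse (?D N (m - 1))"
    using assms(1) by (intro mixed_qpochhammer_telescope[OF q0]) simp
  \<comment> \<open>Expanding the fraction by the unit \<open>?P\<close> supplies the exponents
    divisible by m that $D_{N,m-1}$ omits.\<close>
  also have "\<dots> = ?P / (?D N (m - 1) * ?P)"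
  proof -
    have "?P / (?D N (m - 1) * ?P) = inverse (?D N (m - 1)) * (inverse ?P * ?P)"
      using D0 P0 by (simp add: fps_divide_unit fps_inverse_mult algebra_simps)
    also have "inverse ?P * ?P = 1"
      using P0 by (intro inverse_mult_eq_1) simp
    finally show ?thesis
      by simp
  qed
  also have "?D N (m - 1) * ?P = qpochhammer q q (m * N)"
  proof -
    \<comment> \<open>The class r = m is \<open>?P\<close>; the remaining classes form
      $D_{N,m-1}$.\<close>
    have "{1..m} = insert m {1..m-1}"
      using assms(1) by auto
    moreover have "m \<notin> {1..m-1}"
      using assms(1) by auto
    ultimately show ?thesis
      by (simp add: mixed_qpochhammer_def qpochhammer_mult_index[of q m] mult.commute[of _ ?P])
  qed
  finally show ?thesis
    by (simp add: mixed_qpochhammer_def)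
qed

end
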